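(* Let $r\ge 1$, let $n_0$ be a non-negative integer, and let $\chi_1,\ldots,\chi_r$ be non-principal Dirichlet characters. Let $(s_1,\ldots,s_r)\in\mathbb{C}^r$ satisfy $\sigma_r+\sigma_{r-1}+\cdots+\sigma_{r-i}>0$ for $0\le i\le r-1$, where $\sigma_i=\Re(s_i)$. Then the iterated series (summed first over $n_r$, then $n_{r-1}$, ..., finally $n_1$) $$\sum_{n_1=1}^{\infty}\sum_{n_2=1}^{\infty}\cdots\sum_{n_r=1}^{\infty}\frac{\chi_1(n_1)\chi_2(n_2)\cdots\chi_r(n_r)}{(n_0+n_1)^{s_1}(n_0+n_1+n_2)^{s_2}\cdots(n_0+n_1+\cdots+n_r)^{s_r}}$$ converges and equals $$\int_{1}^\infty\int_{1}^\infty\cdots\int_{1}^\infty\prod_{i=1}^r\Big(\sum_{n_i\le t_i}\chi_i(n_i)\Big)\left(\sum_{\substack{k_1+k_2+\cdots+k_r=r\\ k_1+\cdots+k_i\le i,\ 1\le i\le r\\ 0\le k_i\le i,\ 1\le i\le r}}\binom{1}{k_1}\prod_{i=2}^r\binom{i-k_1-\cdots-k_{i-1}}{k_i}\prod_{i=1}^r\frac{(s_i)_{k_i}}{\big(n_0+\sum_{j=1}^i t_j\big)^{s_i+k_i}}\right)dt_r\,dt_{r-1}\cdots dt_1,$$ where the sum is over integer tuples $(k_1,\ldots,k_r)$ and the integrals are iterated (innermost over $t_r$, outermost over $t_1$).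
   Context: $(s)_k=s(s+1)\cdots(s+k-1)$ for positive integers $k$ and $(s)_0=1$. Binomial coefficients $\binom{n}{k}$ are taken to be $0$ if $k<0$ or $k>n$. Powers $a^{s}$ with $a>0$ real denote $e^{s\log a}$ with the real logarithm. *)

theory Defs
  imports "HOL-Analysis.Analysis"
begin

definition dirichlet_character :: "nat \<Rightarrow> (nat \<Rightarrow> complex) \<Rightarrow> bool" where
  "dirichlet_character m \<psi> \<longleftrightarrow>
     m > 0 \<and>
     (\<forall>a b. \<psi> (a * b) = \<psi> a * \<psi> b) \<and>
     (\<forall>a. \<psi> (a + m) = \<psi> a) \<and>
     (\<forall>a. \<psi> a \<noteq> 0 \<longleftrightarrow> coprime a m)"

definition principal_character :: "nat \<Rightarrow> nat \<Rightarrow> complex" where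
  "principal_character m a = (if coprime a m then 1 else 0)"

definition character_sum :: "(nat \<Rightarrow> complex) \<Rightarrow> real \<Rightarrow> complex" where
  "character_sum \<psi> t = (\<Sum>n | 1 \<le> n \<and> real n \<le> t. \<psi> n)"

text \<open>
  In the following four functions, the series (integrals) run over the \<open>d\<close> coordinates
  \<open>i, i + 1, \<dots>, i + d - 1\<close> of \<open>x\<close>, with coordinate \<open>i\<close> outermost; the other coordinates
  of \<open>x\<close> are parameters. Each variable of a series starts at 1. Since \<open>suminf\<close> and the
  Lebesgue integral are total functions, convergence at every level and for all admissible
  values of the outer variables is expressed separately.
\<close>

primrec iterated_suminf :: "((nat \<Rightarrow> nat) \<Rightarrow> complex) \<Rightarrow> nat \<Rightarrow> nat \<Rightarrow> (nat \<Rightarrow> nat) \<Rightarrow> complex" where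
  "iterated_suminf f i 0 x = f x"
| "iterated_suminf f i (Suc d) x = (\<Sum>n. iterated_suminf f (Suc i) d (x(i := Suc n)))"

primrec iterated_summable :: "((nat \<Rightarrow> nat) \<Rightarrow> complex) \<Rightarrow> nat \<Rightarrow> nat \<Rightarrow> (nat \<Rightarrow> nat) \<Rightarrow> bool" where
  "iterated_summable f i 0 x \<longleftrightarrow> True"
| "iterated_summable f i (Suc d) x \<longleftrightarrow>
     (\<forall>n. iterated_summable f (Suc i) d (x(i := Suc n))) \<and>
     summable (\<lambda>n. iterated_suminf f (Suc i) d (x(i := Suc n)))"

primrec iterated_integral :: "((nat \<Rightarrow> real) \<Rightarrow> complex) \<Rightarrow> nat \<Rightarrow> nat \<Rightarrow> (nat \<Rightarrow> real) \<Rightarrow> complex" where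
  "iterated_integral f i 0 x = f x"
| "iterated_integral f i (Suc d) x =
     (LINT t:{1..}|lborel. iterated_integral f (Suc i) d (x(i := t)))"

primrec iterated_integrable :: "((nat \<Rightarrow> real) \<Rightarrow> complex) \<Rightarrow> nat \<Rightarrow> nat \<Rightarrow> (nat \<Rightarrow> real) \<Rightarrow> bool" where
  "iterated_integrable f i 0 x \<longleftrightarrow> True"
| "iterated_integrable f i (Suc d) x \<longleftrightarrow>
     (\<forall>t\<ge>1. iterated_integrable f (Suc i) d (x(i := t))) \<and>
     set_integrable lborel {1..} (\<lambda>t. iterated_integral f (Suc i) d (x(i := t)))"

definition series_term ::
  "nat \<Rightarrow> nat \<Rightarrow> (nat \<Rightarrow> nat \<Rightarrow> complex) \<Rightarrow> (nat \<Rightarrow> complex) \<Rightarrow> (nat \<Rightarrow> nat) \<Rightarrow> complex" where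
  "series_term r n\<^sub>0 \<psi> s n =
     (\<Prod>i=1..r. \<psi> i (n i)) / (\<Prod>i=1..r. of_nat (n\<^sub>0 + (\<Sum>j=1..i. n j)) powr s i)"

definition index_tuples :: "nat \<Rightarrow> (nat \<Rightarrow> nat) set" where
  "index_tuples r = {k \<in> (\<Pi>\<^sub>E i\<in>{1..r}. {0..i}).
     (\<Sum>i=1..r. k i) = r \<and> (\<forall>i\<in>{1..r}. (\<Sum>j=1..i. k j) \<le> i)}"

text \<open>
  For \<open>k \<in> index_tuples r\<close> and \<open>2 \<le> i \<le> r\<close>, the partial sum
  \<open>k 1 + \<dots> + k (i - 1)\<close> is at most \<open>i - 1\<close>, so the subtraction on \<^typ>\<open>nat\<close> below never truncates.
\<close>

definition integrand ::
  "nat \<Rightarrow> nat \<Rightarrow> (nat \<Rightarrow> nat \<Rightarrow> complex) \<Rightarrow> (nat \<Rightarrow> complex) \<Rightarrow> (nat \<Rightarrow> real) \<Rightarrow> complex" where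
  "integrand r n\<^sub>0 \<psi> s t =
     (\<Prod>i=1..r. character_sum (\<psi> i) (t i)) *
     (\<Sum>k\<in>index_tuples r.
        of_nat (1 choose k 1) *
        (\<Prod>i=2..r. of_nat ((i - (\<Sum>j=1..i-1. k j)) choose k i)) *
        (\<Prod>i=1..r. pochhammer (s i) (k i) /
           of_real (real n\<^sub>0 + (\<Sum>j=1..i. t j)) powr (s i + of_nat (k i))))"

end

theory Submission
  imports Defs
begin

text \<open>
  Abel summation turns \<open>\<Sum>n. \<psi> n * g (y + n)\<close> into \<open>- \<integral> S(t) g'(y + t) dt\<close> with the bounded
  summatory function \<open>S\<close> of \<open>\<psi>\<close>. If all derivatives satisfy \<open>g\<^sup>(\<^sup>k\<^sup>) (y) = O(y powr (-\<sigma> - k))\<close> with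
  \<open>\<sigma> > 0\<close>, then the sum is a function of \<open>y\<close> of the same kind. Multiplying by \<open>y powr (-s)\<close> adds
  \<open>Re s\<close> to \<open>\<sigma>\<close>, so the variables can be summed one after the other from the innermost outwards.
  On the integral side, each step is the Leibniz rule: the exponent \<open>k\<^sub>i\<close> counts how many of the
  derivatives \<open>- d/dt\<^sub>j\<close>, \<open>j \<le> i\<close>, fall on the \<open>i\<close>-th factor, and the binomial coefficients choose them.
\<close>

section \<open>Boundedness of the character sums\<close>

lemma character_sum_eq: "character_sum \<psi> t = (\<Sum>n=1..nat \<lfloor>t\<rfloor>. \<psi> n)"
proof -
  have "{n::nat. 1 \<le> n \<and> real n \<le> t} = {1..nat \<lfloor>t\<rfloor>}"
    by (auto simp: le_nat_floor) linarith
  then show ?thesis by (simp add: character_sum_def)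
qed

lemma borel_measurable_character_sum [measurable]: "character_sum \<psi> \<in> borel_measurable borel"
proof -
  have "(\<lambda>t::real. (\<lambda>N. \<Sum>n=1..nat N. \<psi> n) \<lfloor>t\<rfloor>) \<in> borel_measurable borel"
    by measurable
  then show ?thesis by (simp add: character_sum_eq[abs_def])
qed

lemma periodic_mod:
  fixes f :: "nat \<Rightarrow> 'a"
  assumes "\<And>a. f (a + m) = f a"
  shows "f (a mod m) = f a"
proof -
  have "f (b + k * m) = f b" for b k
  proof (induction k)
    case (Suc k)
    have "f (b + Suc k * m) = f (b + k * m + m)"
      by (simp add: algebra_simps)
    then show ?case using assms Suc by simp
  qed simp
  from this[of "a mod m" "a div m"] show ?thesis by simp
qed

text \<open>Multiplication by a unit \<open>a\<close> permutes the residues modulo \<open>m\<close>,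
  so the sum equals \<open>\<psi> a\<close> times itself. Choosing \<open>a\<close> with
  \<open>\<psi> a\<close> different from 1 forces the sum to vanish.\<close>

lemma dirichlet_character_sum_period:
  assumes "dirichlet_character m \<psi>" "\<psi> \<noteq> principal_character m"
  shows "(\<Sum>n<m. \<psi> n) = 0"
proof -
  from assms(1) have m: "m > 0" and mult: "\<And>a b. \<psi> (a * b) = \<psi> a * \<psi> b"
    and per: "\<And>a. \<psi> (a + m) = \<psi> a" and nz: "\<And>a. \<psi> a \<noteq> 0 \<longleftrightarrow> coprime a m"
    by (auto simp: dirichlet_character_def)
  have permod: "\<psi> (a mod m) = \<psi> a" for a
    using periodic_mod[of \<psi> m] per by blast
  \<comment> \<open>Both functions vanish at arguments not coprime to \<open>m\<close>, so they can
    differ only at a unit, where the principal character is 1.\<close>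
  obtain a where a: "coprime a m" "\<psi> a \<noteq> 1"
    using assms(2) nz by (auto simp: fun_eq_iff principal_character_def split: if_splits)
  have inj: "inj_on (\<lambda>n. a * n mod m) {..<m}"
  proof (rule inj_onI)
    fix x y assume xy: "x \<in> {..<m}" "y \<in> {..<m}" and eq: "a * x mod m = a * y mod m"
    have "int (a * x) mod int m = int (a * y) mod int m"
      using eq by (metis of_nat_mod)
    then have "int m dvd int a * (int x - int y)"
      by (simp add: mod_eq_dvd_iff right_diff_distrib)
    then have "int m dvd int x - int y"
      using a(1) by (simp add: coprime_dvd_mult_right_iff coprime_commute)
    then have "int x mod int m = int y mod int m"
      by (simp add: mod_eq_dvd_iff)
    then show "x = y" using xy by simp
  qed
  have "(\<lambda>n. a * n mod m) ` {..<m} = {..<m}"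
    by (rule endo_inj_surj) (use inj m in auto)
  then have "(\<Sum>n<m. \<psi> n) = (\<Sum>n<m. \<psi> (a * n mod m))"
    using sum.reindex[OF inj, of \<psi>] by simp
  also have "\<dots> = \<psi> a * (\<Sum>n<m. \<psi> n)"
    by (simp add: permod mult sum_distrib_left)
  finally show ?thesis using a(2) by (simp add: field_simps)
qed

text \<open>A full period contributes 0, so the partial sums are periodic themselves and take at
  most \<open>m\<close> values.\<close>

lemma character_sum_bounded:
  assumes "dirichlet_character m \<psi>" "\<psi> \<noteq> principal_character m"
  obtains B where "\<And>t. norm (character_sum \<psi> t) \<le> B"
proof -
  from assms(1) have m: "m > 0" and per: "\<And>a. \<psi> (a + m) = \<psi> a"
    by (auto simp: dirichlet_character_def)
  define P where "P N = (\<Sum>n<N. \<psi> n)" for N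
  have "P (N + m) = P N" for N
    using dirichlet_character_sum_period[OF assms] per
    by (induction N) (simp_all add: P_def)
  then have Pmod: "P (N mod m) = P N" for N
    using periodic_mod[of P m] by blast
  have P_bound: "norm (P N) \<le> (\<Sum>n<m. norm (\<psi> n))" for N
  proof -
    have "norm (P (N mod m)) \<le> (\<Sum>n<(N mod m). norm (\<psi> n))"
      unfolding P_def by (rule norm_sum)
    also have "\<dots> \<le> (\<Sum>n<m. norm (\<psi> n))"
      using m by (intro sum_mono2) (auto intro: less_trans[OF _ mod_less_divisor])
    finally show ?thesis by (simp add: Pmod)
  qed
  have "norm (character_sum \<psi> t) \<le> (\<Sum>n<m. norm (\<psi> n)) + norm (\<psi> 0)" for t
  proof -
    \<comment> \<open>\<open>P\<close> starts at \<open>n = 0\<close>, the character sum at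
      \<open>n = 1\<close>; the difference is the extra term \<open>\<psi> 0\<close> in the
      bound.\<close>
    have "P (Suc (nat \<lfloor>t\<rfloor>)) = \<psi> 0 + character_sum \<psi> t"
      unfolding P_def character_sum_eq
      by (subst lessThan_Suc_atMost, subst atLeast0AtMost[symmetric], subst sum.atLeast_Suc_atMost) auto
    then have "character_sum \<psi> t = P (Suc (nat \<lfloor>t\<rfloor>)) - \<psi> 0" by simp
    then show ?thesis
      using norm_triangle_ineq4[of "P (Suc (nat \<lfloor>t\<rfloor>))" "\<psi> 0"] P_bound[of "Suc (nat \<lfloor>t\<rfloor>)"] by simp
  qed
  then show ?thesis by (rule that)
qed

section \<open>Functions whose derivatives decay like powers\<close>

text \<open>The antiderivative \<open>- (y + t) powr (-a) / a\<close> tends to 0 at infinity because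
  \<open>a > 0\<close>. With \<open>a = \<sigma> + k\<close> this power is the dominating function
  for every integral against a bounded character sum.\<close>

lemma shifted_powr_integral:
  fixes a y :: real
  assumes "a > 0" "y \<ge> 0"
  shows "set_integrable lborel {1..} (\<lambda>t. (y + t) powr (-a - 1))"
    and "(LINT t:{1..}|lborel. (y + t) powr (-a - 1)) = (y + 1) powr (-a) / a"
proof -
  let ?f = "\<lambda>t. indicator {1..} t *\<^sub>R (y + t) powr (-a - 1)"
  have lim: "((\<lambda>t. - ((y + t) powr (-a) / a)) \<longlongrightarrow> - (0 / a)) at_top"
    using assms
    by (intro tendsto_intros tendsto_neg_powr filterlim_tendsto_add_at_top[OF tendsto_const])
       (auto simp: filterlim_ident)
  have der: "((\<lambda>t. - ((y + t) powr (-a) / a)) has_real_derivative (y + t) powr (-a - 1)) (at t)"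
    if "1 \<le> t" for t
  proof -
    have "y + t \<noteq> 0" "0 < y + t" using that assms by auto
    then show ?thesis
      using assms by (auto intro!: derivative_eq_intros simp: powr_diff divide_simps)
  qed
  have "(\<integral>\<^sup>+t. ennreal (?f t) \<partial>lborel) = (\<integral>\<^sup>+t. ennreal ((y + t) powr (-a - 1)) * indicator {1..} t \<partial>lborel)"
    by (intro nn_integral_cong) (auto split: split_indicator)
  also have "\<dots> = ennreal (- (0 / a) - (- ((y + 1) powr (-a) / a)))"
    by (rule nn_integral_FTC_atLeast[OF _ der _ lim]) auto
  finally have "has_bochner_integral lborel ?f ((y + 1) powr (-a) / a)"
    using assms by (intro has_bochner_integral_nn_integral) auto
  then show "set_integrable lborel {1..} (\<lambda>t. (y + t) powr (-a - 1))"
    and "(LINT t:{1..}|lborel. (y + t) powr (-a - 1)) = (y + 1) powr (-a) / a"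
    by (auto simp: set_integrable_def set_lebesgue_integral_def has_bochner_integral_iff)
qed

text \<open>
  \<open>G k\<close> stands for the \<open>k\<close>-th derivative of \<open>G 0\<close> times \<open>(-1)^k\<close>; with this sign convention no signs
  occur in the Leibniz rule or in Abel summation.
\<close>

definition symbol :: "real \<Rightarrow> (nat \<Rightarrow> real \<Rightarrow> complex) \<Rightarrow> bool" where
  "symbol \<sigma> G \<longleftrightarrow>
     (\<forall>k. \<forall>y>0. (G k has_vector_derivative - G (Suc k) y) (at y)) \<and>
     (\<forall>k. \<exists>C. \<forall>y\<ge>1. norm (G k y) \<le> C * y powr (-\<sigma> - real k))"

definition leibniz_mult ::
  "(nat \<Rightarrow> real \<Rightarrow> complex) \<Rightarrow> (nat \<Rightarrow> real \<Rightarrow> complex) \<Rightarrow> nat \<Rightarrow> real \<Rightarrow> complex" where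
  "leibniz_mult F G k y = (\<Sum>j\<le>k. of_nat (k choose j) * F j y * G (k - j) y)"

text \<open>These are the derivatives of \<open>y powr (-s)\<close> with the sign
  \<open>(-1)^k\<close> removed: each differentiation contributes the next factor of the rising
  factorial. They are also the factors that occur in \<open>integrand\<close>.\<close>

definition powr_symbol :: "complex \<Rightarrow> nat \<Rightarrow> real \<Rightarrow> complex" where
  "powr_symbol s k y = pochhammer s k / of_real y powr (s + of_nat k)"

text \<open>By Abel summation this is the value of the series over \<open>n\<close> of
  \<open>\<psi> n * G k (y + n)\<close>. The index \<open>Suc k\<close> appears because
  \<open>G (Suc k)\<close> is minus the derivative of \<open>G k\<close>.\<close>

definition char_integral ::
  "(nat \<Rightarrow> complex) \<Rightarrow> (nat \<Rightarrow> real \<Rightarrow> complex) \<Rightarrow> nat \<Rightarrow> real \<Rightarrow> complex" where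
  "char_integral \<psi> G k y = (LINT t:{1..}|lborel. character_sum \<psi> t * G (Suc k) (y + t))"

lemma symbol_has_derivative:
  "symbol \<sigma> G \<Longrightarrow> y > 0 \<Longrightarrow> (G k has_vector_derivative - G (Suc k) y) (at y)"
  by (simp add: symbol_def)

text \<open>Replacing the constant by its absolute value makes it nonnegative, so that bounds can be
  multiplied.\<close>

lemma symbol_bound:
  assumes "symbol \<sigma> G"
  obtains C where "C \<ge> 0" "\<And>y. y \<ge> 1 \<Longrightarrow> norm (G k y) \<le> C * y powr (-\<sigma> - real k)"
proof -
  obtain C where C: "\<And>y. y \<ge> 1 \<Longrightarrow> norm (G k y) \<le> C * y powr (-\<sigma> - real k)"
    using assms unfolding symbol_def by blast
  show ?thesis
  proof (rule that[of "\<bar>C\<bar>"])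
    fix y :: real assume "y \<ge> 1"
    show "norm (G k y) \<le> \<bar>C\<bar> * y powr (-\<sigma> - real k)"
      by (rule order_trans[OF C[OF \<open>y \<ge> 1\<close>]]) (intro mult_right_mono, auto)
  qed simp
qed

lemma symbol_continuous_on:
  assumes "symbol \<sigma> G"
  shows "continuous_on {0<..} (G k)"
proof (rule continuous_on_vector_derivative)
  fix y :: real assume "y \<in> {0<..}"
  then show "(G k has_vector_derivative - G (Suc k) y) (at y within {0<..})"
    by (auto intro: has_vector_derivative_at_within[OF symbol_has_derivative[OF assms]])
qed

text \<open>The constant function 1 is the value of the sum over no variables; it starts the
  induction with decay exponent 0.\<close>

lemma symbol_one: "symbol 0 (\<lambda>k y. if k = 0 then 1 else 0)"
proof -
  have "\<exists>C. \<forall>y\<ge>1. norm (if k = 0 then 1 else 0 :: complex) \<le> C * y powr (- real k)" for k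
    by (intro exI[of _ 1]) auto
  then show ?thesis by (auto simp: symbol_def)
qed

text \<open>Differentiation brings down the factor \<open>- (s + k)\<close>, which extends the
  Pochhammer symbol by one factor. For real \<open>y > 0\<close> the modulus of the complex power
  depends only on the real part of its exponent, which gives the bound.\<close>

lemma symbol_powr: "symbol (Re s) (powr_symbol s)"
  unfolding symbol_def
proof (intro conjI allI impI)
  fix k :: nat and y :: real assume y: "y > 0"
  have eq: "powr_symbol s k = (\<lambda>y. pochhammer s k * of_real y powr (- (s + of_nat k)))" for k
    unfolding powr_symbol_def powr_minus divide_inverse by (rule refl)
  have nz: "complex_of_real y \<notin> \<real>\<^sub>\<le>\<^sub>0"
    using y by (auto simp: complex_nonpos_Reals_iff)
  have exponent: "- (s + of_nat k) - 1 = - (s + of_nat (Suc k))" by simp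
  \<comment> \<open>The power is differentiated as a complex function, away from the branch cut, and
    the result is then restricted to the real axis.\<close>
  have "((\<lambda>z. pochhammer s k * z powr (- (s + of_nat k))) has_field_derivative
          pochhammer s k * (- (s + of_nat k) * complex_of_real y powr (- (s + of_nat k) - 1))) (at (of_real y))"
    using nz by (intro DERIV_cmult has_field_derivative_powr)
  also have "pochhammer s k * (- (s + of_nat k) * complex_of_real y powr (- (s + of_nat k) - 1)) =
               - powr_symbol s (Suc k) y"
    unfolding eq exponent pochhammer_Suc by (simp only: mult_minus_left mult_minus_right mult.assoc)
  finally show "(powr_symbol s k has_vector_derivative - powr_symbol s (Suc k) y) (at y)"
    unfolding eq[of k] by (rule has_vector_derivative_real_field)
next
  fix k :: nat
  show "\<exists>C. \<forall>y\<ge>1. norm (powr_symbol s k y) \<le> C * y powr (- Re s - real k)"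
  proof (intro exI[of _ "norm (pochhammer s k)"] allI impI)
    fix y :: real assume "y \<ge> 1"
    then have "norm (powr_symbol s k y) = norm (pochhammer s k) / y powr (Re s + real k)"
      by (simp add: powr_symbol_def norm_divide norm_powr_real_powr)
    also have "\<dots> = norm (pochhammer s k) * y powr (- (Re s + real k))"
      by (simp only: powr_minus divide_inverse)
    finally show "norm (powr_symbol s k y) \<le> norm (pochhammer s k) * y powr (- Re s - real k)"
      by simp
  qed
qed

text \<open>Pascal's rule: the two parts of \<open>Suc k choose Suc j\<close> account for the last
  derivative falling on \<open>a\<close> or on \<open>b\<close>.\<close>

lemma leibniz_step:
  fixes a b :: "nat \<Rightarrow> complex"
  shows "(\<Sum>j\<le>k. of_nat (k choose j) * (a (Suc j) * b (k - j) + a j * b (Suc (k - j)))) =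
         (\<Sum>j\<le>Suc k. of_nat (Suc k choose j) * a j * b (Suc k - j))"
proof -
  have "(\<Sum>j\<le>Suc k. of_nat (Suc k choose j) * a j * b (Suc k - j)) =
        a 0 * b (Suc k) + (\<Sum>j\<le>k. of_nat ((k choose j) + (k choose Suc j)) * a (Suc j) * b (k - j))"
    by (subst sum.atMost_Suc_shift) simp
  also have "\<dots> = (\<Sum>j\<le>k. of_nat (k choose j) * a (Suc j) * b (k - j)) +
      (a 0 * b (Suc k) + (\<Sum>j\<le>k. of_nat (k choose Suc j) * a (Suc j) * b (k - j)))"
    by (simp add: sum.distrib algebra_simps)
  also have "a 0 * b (Suc k) + (\<Sum>j\<le>k. of_nat (k choose Suc j) * a (Suc j) * b (k - j)) =
      (\<Sum>j\<le>Suc k. of_nat (k choose j) * a j * b (Suc k - j))"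
    by (subst sum.atMost_Suc_shift) simp
  \<comment> \<open>The top term \<open>j = Suc k\<close> drops out because
    \<open>k choose Suc k = 0\<close>.\<close>
  also have "\<dots> = (\<Sum>j\<le>k. of_nat (k choose j) * a j * b (Suc (k - j)))"
    by (simp add: Suc_diff_le)
  finally show ?thesis by (simp add: sum.distrib algebra_simps)
qed

text \<open>In each Leibniz term the derivatives add up to \<open>k\<close>, so every term decays
  with the same exponent \<open>\<sigma> + \<tau> + k\<close>, however they are distributed.\<close>

lemma symbol_leibniz_mult:
  assumes F: "symbol \<sigma> F" and G: "symbol \<tau> G"
  shows "symbol (\<sigma> + \<tau>) (leibniz_mult F G)"
  unfolding symbol_def
proof (intro conjI allI impI)
  fix k :: nat and y :: real assume y: "y > 0"
  have "((\<lambda>y. \<Sum>j\<le>k. of_nat (k choose j) * F j y * G (k - j) y) has_vector_derivative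
     (\<Sum>j\<le>k. of_nat (k choose j) * F j y * - G (Suc (k - j)) y +
        of_nat (k choose j) * - F (Suc j) y * G (k - j) y)) (at y)"
    by (intro has_vector_derivative_sum has_vector_derivative_mult has_vector_derivative_mult_right
          symbol_has_derivative[OF F y] symbol_has_derivative[OF G y])
  also have "(\<Sum>j\<le>k. of_nat (k choose j) * F j y * - G (Suc (k - j)) y +
        of_nat (k choose j) * - F (Suc j) y * G (k - j) y) = 
     - (\<Sum>j\<le>k. of_nat (k choose j) * (F (Suc j) y * G (k - j) y + F j y * G (Suc (k - j)) y))"
    unfolding sum_negf[symmetric] by (intro sum.cong) (simp_all add: algebra_simps)
  also have "\<dots> = - leibniz_mult F G (Suc k) y"
    unfolding leibniz_mult_def by (subst leibniz_step[where a = "\<lambda>j. F j y" and b = "\<lambda>j. G j y"]) simp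
  finally show "(leibniz_mult F G k has_vector_derivative - leibniz_mult F G (Suc k) y) (at y)"
    by (simp add: leibniz_mult_def[abs_def])
next
  fix k :: nat
  \<comment> \<open>The bound for index \<open>k\<close> combines the constants of all indices
    \<open>j \<le> k\<close>, so they are chosen as functions of \<open>j\<close>.\<close>
  have "\<exists>C. C \<ge> 0 \<and> (\<forall>y\<ge>1. norm (F j y) \<le> C * y powr (-\<sigma> - real j))" for j
    by (rule symbol_bound[OF F, of j]) blast
  then have "\<exists>A. \<forall>j. A j \<ge> 0 \<and> (\<forall>y\<ge>1. norm (F j y) \<le> A j * y powr (-\<sigma> - real j))"
    by (intro choice allI)
  then obtain A where A: "A j \<ge> 0" "\<And>y. y \<ge> 1 \<Longrightarrow> norm (F j y) \<le> A j * y powr (-\<sigma> - real j)" for j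
    by blast
  have "\<exists>C. C \<ge> 0 \<and> (\<forall>y\<ge>1. norm (G j y) \<le> C * y powr (-\<tau> - real j))" for j
    by (rule symbol_bound[OF G, of j]) blast
  then have "\<exists>B. \<forall>j. B j \<ge> 0 \<and> (\<forall>y\<ge>1. norm (G j y) \<le> B j * y powr (-\<tau> - real j))"
    by (intro choice allI)
  then obtain B where B: "B j \<ge> 0" "\<And>y. y \<ge> 1 \<Longrightarrow> norm (G j y) \<le> B j * y powr (-\<tau> - real j)" for j
    by blast
  show "\<exists>C. \<forall>y\<ge>1. norm (leibniz_mult F G k y) \<le> C * y powr (- (\<sigma> + \<tau>) - real k)"
  proof (intro exI[of _ "\<Sum>j\<le>k. real (k choose j) * A j * B (k - j)"] allI impI)
    fix y :: real assume y: "y \<ge> 1"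
    have "norm (leibniz_mult F G k y) \<le> (\<Sum>j\<le>k. real (k choose j) * norm (F j y) * norm (G (k - j) y))"
      unfolding leibniz_mult_def by (rule sum_norm_le) (simp add: norm_mult)
    also have "\<dots> \<le> (\<Sum>j\<le>k. real (k choose j) * A j * B (k - j) * y powr (- (\<sigma> + \<tau>) - real k))"
    proof (rule sum_mono)
      fix j assume j: "j \<in> {..k}"
      have "norm (F j y) * norm (G (k - j) y) \<le>
          (A j * y powr (-\<sigma> - real j)) * (B (k - j) * y powr (-\<tau> - real (k - j)))"
        using A B y by (intro mult_mono) auto
      also have "\<dots> = A j * B (k - j) * (y powr (-\<sigma> - real j) * y powr (-\<tau> - real (k - j)))"
        by simp
      also have "y powr (-\<sigma> - real j) * y powr (-\<tau> - real (k - j)) = y powr (- (\<sigma> + \<tau>) - real k)"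
        using j by (simp add: powr_add[symmetric] of_nat_diff algebra_simps)
      finally have "real (k choose j) * (norm (F j y) * norm (G (k - j) y)) \<le>
          real (k choose j) * (A j * B (k - j) * y powr (- (\<sigma> + \<tau>) - real k))"
        by (rule mult_left_mono) simp
      then show "real (k choose j) * norm (F j y) * norm (G (k - j) y) \<le>
          real (k choose j) * A j * B (k - j) * y powr (- (\<sigma> + \<tau>) - real k)"
        by (simp add: mult.assoc)
    qed
    finally show "norm (leibniz_mult F G k y) \<le>
        (\<Sum>j\<le>k. real (k choose j) * A j * B (k - j)) * y powr (- (\<sigma> + \<tau>) - real k)"
      by (simp add: sum_distrib_right)
  qed
qed

section \<open>The integral against a character sum\<close>

text \<open>The additional derivative lowers the exponent to \<open>-\<sigma> - k - 1\<close>, below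
  -1, so boundedness of the character sum gives absolute integrability. Since
  \<open>t \<ge> 1\<close>, the argument \<open>y + t\<close> stays in the range of the symbol
  bounds even for \<open>y = 0\<close>.\<close>

lemma char_integral_integrable:
  assumes G: "symbol \<sigma> G" and \<sigma>: "\<sigma> > 0" and B: "\<And>t. norm (character_sum \<psi> t) \<le> B" and y: "y \<ge> 0"
  shows "set_integrable lborel {1..} (\<lambda>t. character_sum \<psi> t * G (Suc k) (y + t))"
proof -
  obtain C where C: "C \<ge> 0" "\<And>u. u \<ge> 1 \<Longrightarrow> norm (G (Suc k) u) \<le> C * u powr (-\<sigma> - real (Suc k))"
    by (rule symbol_bound[OF G, of "Suc k"]) blast
  have B0: "B \<ge> 0" using B[of 0] norm_ge_zero order_trans by blast
  have int: "set_integrable lborel {1..} (\<lambda>t. (B * C) * (y + t) powr (- (\<sigma> + real k) - 1))"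
    using \<sigma> y by (intro set_integrable_mult_right shifted_powr_integral) auto
  have "continuous_on {1..} (\<lambda>t. G (Suc k) (y + t))"
    by (rule continuous_on_compose2[OF symbol_continuous_on[OF G]]) (use y in \<open>auto intro!: continuous_intros\<close>)
  then have "set_borel_measurable borel {1..} (\<lambda>t. G (Suc k) (y + t))"
    unfolding set_borel_measurable_def by (intro borel_measurable_continuous_on_indicator) auto
  then have "(\<lambda>t. character_sum \<psi> t * (indicator {1..} t *\<^sub>R G (Suc k) (y + t))) \<in> borel_measurable borel"
    unfolding set_borel_measurable_def by measurable
  then have meas: "set_borel_measurable lborel {1..} (\<lambda>t. character_sum \<psi> t * G (Suc k) (y + t))"
    unfolding set_borel_measurable_def by (simp add: mult_scaleR_right)
  show ?thesis
  proof (rule set_integrable_bound[OF int meas], intro AE_I2 impI)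
    fix t :: real assume "t \<in> {1..}"
    then have "norm (G (Suc k) (y + t)) \<le> C * (y + t) powr (-\<sigma> - real (Suc k))"
      using y by (intro C) auto
    then have "norm (character_sum \<psi> t * G (Suc k) (y + t)) \<le> B * (C * (y + t) powr (-\<sigma> - real (Suc k)))"
      unfolding norm_mult using B B0 by (intro mult_mono) auto
    also have "\<dots> = norm (B * C * (y + t) powr (- (\<sigma> + real k) - 1))"
      using B0 C(1) by (simp add: algebra_simps abs_mult)
    finally show "norm (character_sum \<psi> t * G (Suc k) (y + t)) \<le>
        norm (B * C * (y + t) powr (- (\<sigma> + real k) - 1))" .
  qed
qed

text \<open>Integrating the dominating power raises the exponent by one again, which cancels the
  gain from the additional derivative: the decay exponent is preserved. The denominator
  \<open>\<sigma> + k\<close> of the constant comes from this integration.\<close>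

lemma char_integral_bound:
  assumes G: "symbol \<sigma> G" and \<sigma>: "\<sigma> > 0" and B: "\<And>t. norm (character_sum \<psi> t) \<le> B"
  shows "\<exists>C. \<forall>y\<ge>1. norm (char_integral \<psi> G k y) \<le> C * y powr (-\<sigma> - real k)"
proof -
  obtain C where C: "C \<ge> 0" "\<And>u. u \<ge> 1 \<Longrightarrow> norm (G (Suc k) u) \<le> C * u powr (-\<sigma> - real (Suc k))"
    by (rule symbol_bound[OF G, of "Suc k"]) blast
  have B0: "B \<ge> 0" using B[of 0] norm_ge_zero order_trans by blast
  show ?thesis
  proof (intro exI[of _ "B * C / (\<sigma> + real k)"] allI impI)
    fix y :: real assume y: "y \<ge> 1"
    have int: "set_integrable lborel {1..} (\<lambda>t. character_sum \<psi> t * G (Suc k) (y + t))"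
      using y by (intro char_integral_integrable[OF G \<sigma> B]) auto
    have "norm (char_integral \<psi> G k y) \<le> (LINT t:{1..}|lborel. norm (character_sum \<psi> t * G (Suc k) (y + t)))"
      unfolding char_integral_def by (rule set_integral_norm_bound[OF int])
    also have "\<dots> \<le> (LINT t:{1..}|lborel. (B * C) * (y + t) powr (- (\<sigma> + real k) - 1))"
    proof (rule set_integral_mono[OF set_integrable_norm[OF int]])
      show "set_integrable lborel {1..} (\<lambda>t. (B * C) * (y + t) powr (- (\<sigma> + real k) - 1))"
        using \<sigma> y by (intro set_integrable_mult_right shifted_powr_integral) auto
      fix t :: real assume "t \<in> {1..}"
      then have "norm (G (Suc k) (y + t)) \<le> C * (y + t) powr (-\<sigma> - real (Suc k))"
        using y by (intro C) auto
      then have "norm (character_sum \<psi> t * G (Suc k) (y + t)) \<le> B * (C * (y + t) powr (-\<sigma> - real (Suc k)))"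
        unfolding norm_mult using B B0 by (intro mult_mono) auto
      then show "norm (character_sum \<psi> t * G (Suc k) (y + t)) \<le> B * C * (y + t) powr (- (\<sigma> + real k) - 1)"
        by (simp add: algebra_simps)
    qed
    also have "\<dots> = B * C * ((y + 1) powr (- (\<sigma> + real k)) / (\<sigma> + real k))"
      using \<sigma> y by (simp add: shifted_powr_integral(2)[of "\<sigma> + real k" y, simplified])
    also have "\<dots> \<le> B * C * (y powr (- (\<sigma> + real k)) / (\<sigma> + real k))"
      using \<sigma> y B0 C(1) by (intro mult_left_mono divide_right_mono powr_mono2') auto
    finally show "norm (char_integral \<psi> G k y) \<le> B * C / (\<sigma> + real k) * y powr (-\<sigma> - real k)"
      by simp
  qed
qed

section \<open>Abel summation and termwise differentiation\<close>

lemma character_sum_Suc: "character_sum \<psi> (real (Suc n)) = character_sum \<psi> (real n) + \<psi> (Suc n)"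
  by (simp add: character_sum_eq nat_add_distrib)

lemma symbol_shift_derivative:
  assumes "symbol \<sigma> G" "y + t > 0"
  shows "((\<lambda>t. G k (y + t)) has_vector_derivative - G (Suc k) (y + t)) (at t)"
proof -
  have "((\<lambda>t. y + t) has_vector_derivative 1) (at t)"
    by (auto intro!: derivative_eq_intros)
  from vector_diff_chain_at[OF this symbol_has_derivative[OF assms]] show ?thesis
    by (simp add: o_def)
qed

text \<open>The fundamental theorem of calculus, stated on half-open intervals because these tile
  \<open>{1..}\<close> and the character sum is constant on each \<open>{N..<N+1}\<close>.\<close>

lemma symbol_shift_integral:
  assumes G: "symbol \<sigma> G" and "a \<le> b" "y + a > 0"
  shows "(LINT t:{a..<b}|lborel. G (Suc k) (y + t)) = G k (y + a) - G k (y + b)"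
proof -
  have deriv: "((\<lambda>t. - G k (y + t)) has_vector_derivative G (Suc k) (y + t)) (at t within {a..b})"
    if "a \<le> t" for t
  proof -
    have "((\<lambda>t. G k (y + t)) has_vector_derivative - G (Suc k) (y + t)) (at t)"
      by (rule symbol_shift_derivative[OF G]) (use that assms(3) in simp)
    then show ?thesis
      using has_vector_derivative_minus has_vector_derivative_at_within by fastforce
  qed
  have cont: "continuous_on {a..b} (\<lambda>t. G (Suc k) (y + t))"
    by (rule continuous_on_compose2[OF symbol_continuous_on[OF G]])
       (use assms in \<open>auto intro!: continuous_intros\<close>)
  have cc: "set_integrable lborel {a..b} (\<lambda>t. G (Suc k) (y + t))"
    using borel_integrable_atLeastAtMost'[OF cont] .
  have cc': "set_integrable lborel {a..<b} (\<lambda>t. G (Suc k) (y + t))"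
    by (rule set_integrable_subset[OF cc]) auto
  \<comment> \<open>The fundamental theorem is applied on the closed interval; the endpoint
    \<open>b\<close> is a null set.\<close>
  have "AE t in lborel. t \<noteq> b"
    by (rule AE_lborel_singleton)
  then have "AE t in lborel. (t \<in> {a..b}) = (t \<in> {a..<b})"
    by eventually_elim auto
  then have "(LINT t:{a..<b}|lborel. G (Suc k) (y + t)) = (LINT t:{a..b}|lborel. G (Suc k) (y + t))"
    by (intro set_integral_cong_set)
       (use cc cc' in \<open>simp_all add: set_borel_measurable_def set_integrable_def borel_measurable_integrable\<close>)
  also have "\<dots> = - G k (y + b) - - G k (y + a)"
    unfolding set_lebesgue_integral_def
    using integral_FTC_atLeastAtMost[OF \<open>a \<le> b\<close> deriv cont] by simp
  finally show ?thesis by simp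
qed

text \<open>On each unit interval between consecutive integers the character sum is a constant
  factor, and the remaining integral telescopes to a difference of values of
  \<open>G k\<close>.\<close>

lemma character_sum_partial_integral:
  assumes G: "symbol \<sigma> G" and y: "y \<ge> 0"
    and int: "set_integrable lborel {1..} (\<lambda>t. character_sum \<psi> t * G (Suc k) (y + t))"
  shows "(LINT t:{1..<real (Suc N)}|lborel. character_sum \<psi> t * G (Suc k) (y + t)) =
         (\<Sum>n<N. character_sum \<psi> (real (Suc n)) * (G k (y + real (Suc n)) - G k (y + real (Suc (Suc n)))))"
proof (induction N)
  case 0
  then show ?case by (simp add: set_lebesgue_integral_def)
next
  case (Suc N)
  let ?f = "\<lambda>t. character_sum \<psi> t * G (Suc k) (y + t)"
  let ?I = "{real (Suc N)..<real (Suc (Suc N))}"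
  have split: "{1..<real (Suc (Suc N))} = {1..<real (Suc N)} \<union> ?I"
    by auto
  have "(LINT t:{1..<real (Suc (Suc N))}|lborel. ?f t) = (LINT t:{1..<real (Suc N)}|lborel. ?f t) + (LINT t:?I|lborel. ?f t)"
    unfolding split by (rule set_integral_Un) (auto intro!: set_integrable_subset[OF int])
  also have "(LINT t:?I|lborel. ?f t) = (LINT t:?I|lborel. character_sum \<psi> (real (Suc N)) * G (Suc k) (y + t))"
  proof (rule set_lebesgue_integral_cong; (intro allI impI)?)
    fix t assume "t \<in> ?I"
    then have "\<lfloor>t\<rfloor> = int (Suc N)"
      by (intro floor_unique) auto
    then show "?f t = character_sum \<psi> (real (Suc N)) * G (Suc k) (y + t)"
      by (simp add: character_sum_eq nat_add_distrib)
  qed auto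
  also have "\<dots> = character_sum \<psi> (real (Suc N)) * (G k (y + real (Suc N)) - G k (y + real (Suc (Suc N))))"
    unfolding set_integral_mult_right using y by (subst symbol_shift_integral[OF G]) auto
  finally show ?case using Suc.IH by simp
qed

text \<open>Abel summation for partial sums; \<open>S N * a N\<close> is the boundary term that has
  to vanish in the limit.\<close>

lemma summation_by_parts:
  fixes S a b :: "nat \<Rightarrow> complex"
  assumes "S 0 = 0" "\<And>n. S (Suc n) = S n + b n"
  shows "(\<Sum>n<N. b n * a n) = (\<Sum>n<N. S (Suc n) * (a n - a (Suc n))) + S N * a N"
  using assms by (induction N) (simp_all add: algebra_simps)

text \<open>A partial sum of the series is the integral up to \<open>N + 1\<close> plus a boundary
  term. The integrals converge because the integrand is absolutely integrable; the boundary term is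
  a bounded factor times a null sequence.\<close>

lemma char_integral_sums:
  assumes G: "symbol \<sigma> G" and \<sigma>: "\<sigma> > 0" and B: "\<And>t. norm (character_sum \<psi> t) \<le> B" and y: "y \<ge> 0"
  shows "(\<lambda>n. \<psi> (Suc n) * G k (y + real (Suc n))) sums char_integral \<psi> G k y"
proof -
  let ?f = "\<lambda>t. character_sum \<psi> t * G (Suc k) (y + t)"
  have int: "set_integrable lborel {1..} ?f"
    by (rule char_integral_integrable[OF G \<sigma> B y])
  have union: "(\<Union>N. {1..<real (Suc N)}) = {1..}"
  proof (intro equalityI subsetI)
    fix t :: real assume "t \<in> {1..}"
    moreover obtain N where "t < real N" using reals_Archimedean2 by blast
    ultimately show "t \<in> (\<Union>N. {1..<real (Suc N)})" by (auto intro!: exI[of _ N])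
  qed auto
  have "(\<lambda>N. LINT t:{1..<real (Suc N)}|lborel. ?f t) \<longlonglongrightarrow> (LINT t:(\<Union>N. {1..<real (Suc N)})|lborel. ?f t)"
    by (rule set_integral_cont_up) (use int union in \<open>auto simp: incseq_def\<close>)
  then have lim: "(\<lambda>N. LINT t:{1..<real (Suc N)}|lborel. ?f t) \<longlonglongrightarrow> char_integral \<psi> G k y"
    unfolding union char_integral_def .
  obtain C where C: "C \<ge> 0" "\<And>u. u \<ge> 1 \<Longrightarrow> norm (G k u) \<le> C * u powr (-\<sigma> - real k)"
    by (rule symbol_bound[OF G, of k]) blast
  have B0: "B \<ge> 0" using B[of 0] norm_ge_zero order_trans by blast
  \<comment> \<open>The boundary term decays like a power with exponent
    \<open>-\<sigma> - k\<close>, which is negative even for \<open>k = 0\<close> because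
    \<open>\<sigma> > 0\<close>.\<close>
  have rest: "(\<lambda>N. character_sum \<psi> (real N) * G k (y + real (Suc N))) \<longlonglongrightarrow> 0"
  proof (rule Lim_null_comparison)
    show "\<forall>\<^sub>F N in sequentially. norm (character_sum \<psi> (real N) * G k (y + real (Suc N))) \<le>
        B * (C * (y + real (Suc N)) powr (-\<sigma> - real k))"
      unfolding norm_mult using B B0 C y by (intro always_eventually allI mult_mono) auto
    have "filterlim (\<lambda>N. y + real (Suc N)) at_top sequentially"
      by (intro filterlim_tendsto_add_at_top[OF tendsto_const] filterlim_compose[OF filterlim_real_sequentially filterlim_Suc])
    then have "(\<lambda>N. B * (C * (y + real (Suc N)) powr (-\<sigma> - real k))) \<longlonglongrightarrow> B * (C * 0)"
      using \<sigma> by (intro tendsto_mult tendsto_const tendsto_neg_powr) auto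
    then show "(\<lambda>N. B * (C * (y + real (Suc N)) powr (-\<sigma> - real k))) \<longlonglongrightarrow> 0" by simp
  qed
  have "(\<Sum>n<N. \<psi> (Suc n) * G k (y + real (Suc n))) =
      (LINT t:{1..<real (Suc N)}|lborel. ?f t) + character_sum \<psi> (real N) * G k (y + real (Suc N))" for N
    unfolding character_sum_partial_integral[OF G y int]
    by (rule summation_by_parts[where S = "\<lambda>n. character_sum \<psi> (real n)" and a = "\<lambda>n. G k (y + real (Suc n))"])
       (simp add: character_sum_eq, rule character_sum_Suc)
  then show ?thesis
    unfolding sums_def using tendsto_add[OF lim rest] by simp
qed

text \<open>The Weierstrass M-test makes the series of derivatives converge uniformly, which
  justifies termwise differentiation.\<close>

lemma has_vector_derivative_series:
  fixes f :: "nat \<Rightarrow> real \<Rightarrow> 'a::banach"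
  assumes S: "convex S" "open S"
    and deriv: "\<And>n x. x \<in> S \<Longrightarrow> (f n has_vector_derivative f' n x) (at x)"
    and bound: "\<And>n x. x \<in> S \<Longrightarrow> norm (f' n x) \<le> M n" "summable M"
    and sums: "\<And>x. x \<in> S \<Longrightarrow> (\<lambda>n. f n x) sums g x"
    and x: "x \<in> S"
  shows "(g has_vector_derivative (\<Sum>n. f' n x)) (at x)"
proof -
  have unif: "uniform_limit S (\<lambda>n x. \<Sum>i<n. f' i x) (\<lambda>x. \<Sum>i. f' i x) sequentially"
    by (rule Weierstrass_m_test[OF bound])
  have "\<exists>h. \<forall>x\<in>S. (\<lambda>n. f n x) sums h x \<and>
      (h has_derivative (\<lambda>t. t *\<^sub>R (\<Sum>i. f' i x))) (at x within S)"
  proof (rule has_derivative_series[where f = f and f' = "\<lambda>n x t. t *\<^sub>R f' n x" and x = x and l = "g x"])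
    show "(f n has_derivative (\<lambda>t. t *\<^sub>R f' n x)) (at x within S)" if "x \<in> S" for n x
      using deriv[OF that] by (auto simp: has_vector_derivative_def intro: has_derivative_at_withinI)
    show "\<forall>\<^sub>F n in sequentially. \<forall>x\<in>S. \<forall>t.
        norm ((\<Sum>i<n. t *\<^sub>R f' i x) - t *\<^sub>R (\<Sum>i. f' i x)) \<le> e * norm t" if "e > 0" for e
      using uniform_limitD[OF unif that]
    proof eventually_elim
      case (elim n)
      show ?case
      proof (intro ballI allI)
        fix x t assume "x \<in> S"
        then have "norm ((\<Sum>i<n. f' i x) - (\<Sum>i. f' i x)) \<le> e"
          using elim by (auto simp: dist_norm intro: less_imp_le)
        then have "\<bar>t\<bar> * norm ((\<Sum>i<n. f' i x) - (\<Sum>i. f' i x)) \<le> \<bar>t\<bar> * e"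
          by (rule mult_left_mono) simp
        then show "norm ((\<Sum>i<n. t *\<^sub>R f' i x) - t *\<^sub>R (\<Sum>i. f' i x)) \<le> e * norm t"
          by (simp add: mult.commute flip: scaleR_sum_right scaleR_diff_right)
      qed
    qed
  qed (use S(1) x sums in auto)
  then obtain h where h: "\<And>x. x \<in> S \<Longrightarrow> (\<lambda>n. f n x) sums h x"
    "\<And>x. x \<in> S \<Longrightarrow> (h has_derivative (\<lambda>t. t *\<^sub>R (\<Sum>i. f' i x))) (at x within S)"
    by blast
  \<comment> \<open>\<open>h\<close> is only known as some limit of the series. By uniqueness of
    limits it coincides with \<open>g\<close> on the open set \<open>S\<close>, so the derivative
    carries over.\<close>
  have "(h has_vector_derivative (\<Sum>i. f' i x)) (at x)"
    using h(2)[OF x] unfolding has_vector_derivative_def at_within_open[OF x S(2)] .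
  then show ?thesis
    by (rule has_vector_derivative_transform_within_open[OF _ S(2) x]) (use h(1) sums sums_unique2 in blast)
qed

text \<open>
  The series in \<open>char_integral_sums\<close> need not converge absolutely, but its termwise derivative does,
  uniformly in \<open>y > 0\<close>, so it can be differentiated term by term.
\<close>

lemma char_integral_has_derivative:
  assumes G: "symbol \<sigma> G" and \<sigma>: "\<sigma> > 0" and B: "\<And>t. norm (character_sum \<psi> t) \<le> B" and y: "y > 0"
  shows "(char_integral \<psi> G k has_vector_derivative - char_integral \<psi> G (Suc k) y) (at y)"
proof -
  obtain C where C: "C \<ge> 0" "\<And>u. u \<ge> 1 \<Longrightarrow> norm (G (Suc k) u) \<le> C * u powr (-\<sigma> - real (Suc k))"
    by (rule symbol_bound[OF G, of "Suc k"]) blast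
  have B0: "B \<ge> 0" using B[of 0] norm_ge_zero order_trans by blast
  \<comment> \<open>The factor \<open>2 * B\<close> bounds a character value as a difference of two
    character sums; the power is the symbol bound at \<open>y + n + 1\<close>, made independent of
    \<open>y > 0\<close> by monotonicity. Its exponent is below -1, hence summable.\<close>
  let ?M = "\<lambda>n. 2 * B * (C * real (Suc n) powr (-\<sigma> - real (Suc k)))"
  have \<psi>_bound: "norm (\<psi> (Suc n)) \<le> 2 * B" for n
  proof -
    have "\<psi> (Suc n) = character_sum \<psi> (real (Suc n)) - character_sum \<psi> (real n)"
      by (simp only: character_sum_Suc) simp
    then show ?thesis
      using norm_triangle_ineq4[of "character_sum \<psi> (real (Suc n))" "character_sum \<psi> (real n)"]
        B[of "real (Suc n)"] B[of "real n"] by simp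
  qed
  have "(char_integral \<psi> G k has_vector_derivative (\<Sum>n. \<psi> (Suc n) * - G (Suc k) (y + real (Suc n)))) (at y)"
  proof (rule has_vector_derivative_series[where S = "{0<..}" and M = ?M
        and f = "\<lambda>n y. \<psi> (Suc n) * G k (y + real (Suc n))"
        and f' = "\<lambda>n y. \<psi> (Suc n) * - G (Suc k) (y + real (Suc n))"])
    fix n :: nat and x :: real assume x: "x \<in> {0<..}"
    have "((\<lambda>y. G k (y + real (Suc n))) has_vector_derivative - G (Suc k) (x + real (Suc n))) (at x)"
      using symbol_shift_derivative[OF G, of "real (Suc n)" x k] x by (simp add: add.commute)
    then show "((\<lambda>y. \<psi> (Suc n) * G k (y + real (Suc n))) has_vector_derivative
        \<psi> (Suc n) * - G (Suc k) (x + real (Suc n))) (at x)"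
      by (rule has_vector_derivative_mult_right)
    have "norm (G (Suc k) (x + real (Suc n))) \<le> C * (x + real (Suc n)) powr (-\<sigma> - real (Suc k))"
      using x by (intro C) auto
    also have "\<dots> \<le> C * real (Suc n) powr (-\<sigma> - real (Suc k))"
      using x \<sigma> C(1) by (intro mult_left_mono powr_mono2') auto
    finally show "norm (\<psi> (Suc n) * - G (Suc k) (x + real (Suc n))) \<le> ?M n"
      unfolding norm_mult norm_minus_cancel using \<psi>_bound B0 by (intro mult_mono) auto
    show "(\<lambda>n. \<psi> (Suc n) * G k (x + real (Suc n))) sums char_integral \<psi> G k x"
      using x by (intro char_integral_sums[OF G \<sigma> B]) auto
  next
    have "summable (\<lambda>n. real (Suc n) powr (-\<sigma> - real (Suc k)))"
      using \<sigma> by (subst summable_Suc_iff[where f = "\<lambda>n. real n powr (-\<sigma> - real (Suc k))"])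
        (simp add: summable_real_powr_iff)
    then show "summable ?M" by (intro summable_mult)
  qed (use y in auto)
  also have "(\<Sum>n. \<psi> (Suc n) * - G (Suc k) (y + real (Suc n))) = - char_integral \<psi> G (Suc k) y"
    using sums_minus[OF char_integral_sums[OF G \<sigma> B, where y = y and k = "Suc k"]] y
    by (simp add: sums_iff)
  finally show ?thesis .
qed

lemma symbol_char_integral:
  assumes "symbol \<sigma> G" "\<sigma> > 0" "\<And>t. norm (character_sum \<psi> t) \<le> B"
  shows "symbol \<sigma> (char_integral \<psi> G)"
  unfolding symbol_def
  using char_integral_has_derivative[OF assms] char_integral_bound[OF assms] by blast

section \<open>Exponent tuples and the shape of the integrand\<close>

text \<open>The total may fall short of \<open>q\<close>: the derivatives missing from the first
  \<open>q\<close> factors are those that fall on later ones, and the tail carries them as its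
  index.\<close>

definition partial_tuples :: "nat \<Rightarrow> (nat \<Rightarrow> nat) set" where
  "partial_tuples q = {k \<in> (\<Pi>\<^sub>E i\<in>{1..q}. {0..i}). \<forall>i\<in>{1..q}. (\<Sum>j=1..i. k j) \<le> i}"

text \<open>At factor \<open>i\<close> there are \<open>i\<close> derivatives minus those spent on
  earlier factors, and \<open>k i\<close> of them are chosen. For \<open>i = 1\<close> the inner sum
  is empty and the coefficient is \<open>1 choose k 1\<close>, so the product needs no separate
  first factor.\<close>

definition tuple_weight ::
  "nat \<Rightarrow> (nat \<Rightarrow> complex) \<Rightarrow> nat \<Rightarrow> (nat \<Rightarrow> nat) \<Rightarrow> (nat \<Rightarrow> real) \<Rightarrow> complex" where
  "tuple_weight n\<^sub>0 s q k x =
     (\<Prod>i=1..q. of_nat ((i - (\<Sum>j=1..i-1. k j)) choose k i) *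
        powr_symbol (s i) (k i) (real n\<^sub>0 + (\<Sum>j=1..i. x j)))"

text \<open>
  \<open>tail_symbol r \<psi> s d 0 y\<close> is the value of the sum over the last \<open>d\<close> variables, where \<open>y\<close> is \<open>n\<^sub>0\<close> plus
  the sum of the other variables.
\<close>

primrec tail_symbol ::
  "nat \<Rightarrow> (nat \<Rightarrow> nat \<Rightarrow> complex) \<Rightarrow> (nat \<Rightarrow> complex) \<Rightarrow> nat \<Rightarrow> nat \<Rightarrow> real \<Rightarrow> complex" where
  "tail_symbol r \<psi> s 0 = (\<lambda>k y. if k = 0 then 1 else 0)"
| "tail_symbol r \<psi> s (Suc d) =
     char_integral (\<psi> (r - d)) (leibniz_mult (powr_symbol (s (r - d))) (tail_symbol r \<psi> s d))"

lemma finite_partial_tuples: "finite (partial_tuples q)"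
  unfolding partial_tuples_def by (rule finite_subset[OF _ finite_PiE[of "{1..q}" "\<lambda>i. {0..i}"]]) auto

lemma partial_tuples_0: "partial_tuples 0 = {\<lambda>_. undefined}"
  by (auto simp: partial_tuples_def)

lemma partial_tuples_sum_le: "k \<in> partial_tuples q \<Longrightarrow> (\<Sum>j=1..q. k j) \<le> q"
  by (cases "q = 0") (auto simp: partial_tuples_def)

lemma index_tuples_eq: "index_tuples r = {k \<in> partial_tuples r. (\<Sum>j=1..r. k j) = r}"
  by (auto simp: index_tuples_def partial_tuples_def)

lemma sum_fun_upd_Suc:
  fixes k :: "nat \<Rightarrow> 'a::comm_monoid_add"
  shows "i \<le> q \<Longrightarrow> (\<Sum>j=1..i. (k(Suc q := v)) j) = (\<Sum>j=1..i. k j)"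
  by (intro sum.cong) auto

text \<open>A tuple of length \<open>Suc q\<close> is a tuple of length \<open>q\<close> together
  with a last exponent \<open>v\<close> bounded by the derivatives still available. The inner sum
  then has the range of a Leibniz sum.\<close>

lemma sum_partial_tuples_Suc:
  "(\<Sum>k\<in>partial_tuples (Suc q). f k) =
   (\<Sum>k\<in>partial_tuples q. \<Sum>v\<le>Suc q - (\<Sum>j=1..q. k j). f (k(Suc q := v)))"
proof -
  have fun_upd: "k(Suc q := v) \<in> partial_tuples (Suc q)"
    if "k \<in> partial_tuples q" "v \<le> Suc q - (\<Sum>j=1..q. k j)" for k v
  proof -
    have k: "k \<in> (\<Pi>\<^sub>E i\<in>{1..q}. {0..i})" "\<And>i. i \<in> {1..q} \<Longrightarrow> (\<Sum>j=1..i. k j) \<le> i"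
      using that(1) by (auto simp: partial_tuples_def)
    have "k(Suc q := v) \<in> (\<Pi>\<^sub>E i\<in>insert (Suc q) {1..q}. {0..i})"
      using k(1) that(2) by (intro PiE_fun_upd) auto
    moreover have "insert (Suc q) {1..q} = {1..Suc q}" by auto
    moreover have "(\<Sum>j=1..i. (k(Suc q := v)) j) \<le> i" if i: "i \<in> {1..Suc q}" for i
    proof (cases "i = Suc q")
      case True
      have "(\<Sum>j=1..Suc q. (k(Suc q := v)) j) = (\<Sum>j=1..q. k j) + v"
        using sum_fun_upd_Suc[of q q k v] by simp
      then show ?thesis
        using True partial_tuples_sum_le[OF \<open>k \<in> partial_tuples q\<close>] \<open>v \<le> _\<close> by simp
    next
      case False
      then show ?thesis using k(2)[of i] i sum_fun_upd_Suc[of i q k v] by auto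
    qed
    ultimately show ?thesis by (simp add: partial_tuples_def)
  qed
  have restrict: "k(Suc q := undefined) \<in> partial_tuples q"
      "k (Suc q) \<le> Suc q - (\<Sum>j=1..q. (k(Suc q := undefined)) j)"
    if "k \<in> partial_tuples (Suc q)" for k
  proof -
    have k: "k \<in> (\<Pi>\<^sub>E i\<in>{1..Suc q}. {0..i})" "\<And>i. i \<in> {1..Suc q} \<Longrightarrow> (\<Sum>j=1..i. k j) \<le> i"
      using that by (auto simp: partial_tuples_def)
    show "k(Suc q := undefined) \<in> partial_tuples q"
      unfolding partial_tuples_def
    proof (intro CollectI conjI ballI)
      show "k(Suc q := undefined) \<in> (\<Pi>\<^sub>E i\<in>{1..q}. {0..i})"
        using k(1) by (auto simp: PiE_iff extensional_def)
      fix i assume "i \<in> {1..q}"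
      then show "(\<Sum>j=1..i. (k(Suc q := undefined)) j) \<le> i"
        using k(2)[of i] sum_fun_upd_Suc[of i q k undefined] by auto
    qed
    show "k (Suc q) \<le> Suc q - (\<Sum>j=1..q. (k(Suc q := undefined)) j)"
      using k(2)[of "Suc q"] sum_fun_upd_Suc[of q q k undefined] by auto
  qed
  have "(\<Sum>k\<in>partial_tuples q. \<Sum>v\<le>Suc q - (\<Sum>j=1..q. k j). f (k(Suc q := v))) =
      (\<Sum>(k, v)\<in>(SIGMA k:partial_tuples q. {..Suc q - (\<Sum>j=1..q. k j)}). f (k(Suc q := v)))"
    by (rule sum.Sigma) (auto simp: finite_partial_tuples)
  also have "\<dots> = (\<Sum>k\<in>partial_tuples (Suc q). f k)"
  \<comment> \<open>Resetting coordinate \<open>Suc q\<close> to \<open>undefined\<close>, the value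
    of an extensional function outside its domain, recovers the shorter tuple.\<close>
  proof (rule sum.reindex_bij_witness[where j = "\<lambda>(k, v). k(Suc q := v)"
        and i = "\<lambda>k. (k(Suc q := undefined), k (Suc q))"])
    fix a assume a: "a \<in> (SIGMA k:partial_tuples q. {..Suc q - (\<Sum>j=1..q. k j)})"
    obtain k v where kv: "a = (k, v)" by (cases a)
    have "k (Suc q) = undefined"
      using a kv by (auto simp: partial_tuples_def PiE_iff extensional_def)
    then show "((case a of (k, v) \<Rightarrow> k(Suc q := v))(Suc q := undefined),
        (case a of (k, v) \<Rightarrow> k(Suc q := v)) (Suc q)) = a"
      by (simp add: kv fun_upd_idem)
    show "(case a of (k, v) \<Rightarrow> k(Suc q := v)) \<in> partial_tuples (Suc q)"
      using a kv fun_upd by auto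
    show "f (case a of (k, v) \<Rightarrow> k(Suc q := v)) = (case a of (k, v) \<Rightarrow> f (k(Suc q := v)))"
      by (simp add: kv)
  next
    fix k assume k: "k \<in> partial_tuples (Suc q)"
    show "(case (k(Suc q := undefined), k (Suc q)) of (k, v) \<Rightarrow> k(Suc q := v)) = k"
      by simp
    show "(k(Suc q := undefined), k (Suc q)) \<in> (SIGMA k:partial_tuples q. {..Suc q - (\<Sum>j=1..q. k j)})"
      using restrict[OF k] by auto
  qed
  finally show ?thesis ..
qed

text \<open>The factors with \<open>i \<le> q\<close> involve only coordinates up to
  \<open>q\<close>, so changing coordinate \<open>Suc q\<close> leaves them alone and splits off
  exactly one Leibniz coefficient with its power.\<close>

lemma tuple_weight_Suc:
  "tuple_weight n\<^sub>0 s (Suc q) (k(Suc q := v)) (x(Suc q := t)) =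
   tuple_weight n\<^sub>0 s q k x * (of_nat ((Suc q - (\<Sum>j=1..q. k j)) choose v) *
     powr_symbol (s (Suc q)) v (real n\<^sub>0 + (\<Sum>j=1..q. x j) + t))"
proof -
  have "(\<Prod>i=1..q. of_nat ((i - (\<Sum>j=1..i-1. (k(Suc q := v)) j)) choose (k(Suc q := v)) i) *
        powr_symbol (s i) ((k(Suc q := v)) i) (real n\<^sub>0 + (\<Sum>j=1..i. (x(Suc q := t)) j))) =
      tuple_weight n\<^sub>0 s q k x"
    unfolding tuple_weight_def
  proof (rule prod.cong)
    fix i assume i: "i \<in> {1..q}"
    then have le: "i - 1 \<le> q" "i \<le> q" by auto
    show "of_nat ((i - (\<Sum>j=1..i-1. (k(Suc q := v)) j)) choose (k(Suc q := v)) i) *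
        powr_symbol (s i) ((k(Suc q := v)) i) (real n\<^sub>0 + (\<Sum>j=1..i. (x(Suc q := t)) j)) =
      of_nat ((i - (\<Sum>j=1..i-1. k j)) choose k i) * powr_symbol (s i) (k i) (real n\<^sub>0 + (\<Sum>j=1..i. x j))"
      unfolding sum_fun_upd_Suc[OF le(1)] sum_fun_upd_Suc[OF le(2)] using i by simp
  qed simp
  then show ?thesis
    unfolding tuple_weight_def
    by (simp add: sum_fun_upd_Suc[OF order_refl] add.assoc del: fun_upd_apply)
       (simp add: fun_upd_same)
qed

text \<open>The empty tail is 1 at index 0 and 0 elsewhere, so it acts as the indicator of the
  tuples with total exactly \<open>r\<close>. This puts the integrand in the form on which the
  induction operates.\<close>

lemma integrand_eq:
  assumes "r \<ge> 1"
  shows "integrand r n\<^sub>0 \<psi> s x = (\<Prod>i=1..r. character_sum (\<psi> i) (x i)) *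
      (\<Sum>k\<in>partial_tuples r. tuple_weight n\<^sub>0 s r k x *
         tail_symbol r \<psi> s 0 (r - (\<Sum>j=1..r. k j)) (real n\<^sub>0 + (\<Sum>j=1..r. x j)))"
proof -
  have weight: "of_nat (1 choose k 1) * (\<Prod>i=2..r. of_nat ((i - (\<Sum>j=1..i-1. k j)) choose k i)) *
      (\<Prod>i=1..r. pochhammer (s i) (k i) / of_real (real n\<^sub>0 + (\<Sum>j=1..i. x j)) powr (s i + of_nat (k i))) =
      tuple_weight n\<^sub>0 s r k x" for k
  proof -
    have "(\<Prod>i=1..r. of_nat ((i - (\<Sum>j=1..i-1. k j)) choose k i) :: complex) =
        of_nat (1 choose k 1) * (\<Prod>i=2..r. of_nat ((i - (\<Sum>j=1..i-1. k j)) choose k i))"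
      by (subst prod.atLeast_Suc_atMost[OF assms]) (simp add: numeral_2_eq_2)
    then show ?thesis
      unfolding tuple_weight_def powr_symbol_def prod.distrib by simp
  qed
  have "(\<Sum>k\<in>index_tuples r. tuple_weight n\<^sub>0 s r k x) = (\<Sum>k\<in>partial_tuples r. tuple_weight n\<^sub>0 s r k x *
         tail_symbol r \<psi> s 0 (r - (\<Sum>j=1..r. k j)) (real n\<^sub>0 + (\<Sum>j=1..r. x j)))"
  proof (rule sum.mono_neutral_cong_left)
    show "\<forall>k\<in>partial_tuples r - index_tuples r. tuple_weight n\<^sub>0 s r k x *
         tail_symbol r \<psi> s 0 (r - (\<Sum>j=1..r. k j)) (real n\<^sub>0 + (\<Sum>j=1..r. x j)) = 0"
    proof
      fix k assume "k \<in> partial_tuples r - index_tuples r"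
      then have "(\<Sum>j=1..r. k j) < r"
        using partial_tuples_sum_le[of k r] by (auto simp: index_tuples_eq)
      then show "tuple_weight n\<^sub>0 s r k x *
         tail_symbol r \<psi> s 0 (r - (\<Sum>j=1..r. k j)) (real n\<^sub>0 + (\<Sum>j=1..r. x j)) = 0"
        by simp
    qed
  qed (auto simp: finite_partial_tuples index_tuples_eq)
  then show ?thesis
    unfolding integrand_def weight by simp
qed

section \<open>Induction from the innermost variable outwards\<close>

locale character_series =
  fixes r n\<^sub>0 :: nat and m :: "nat \<Rightarrow> nat" and \<psi> :: "nat \<Rightarrow> nat \<Rightarrow> complex" and s :: "nat \<Rightarrow> complex"
  assumes r: "r \<ge> 1"
    and character: "\<And>i. i \<in> {1..r} \<Longrightarrow> dirichlet_character (m i) (\<psi> i)"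
    and nonprincipal: "\<And>i. i \<in> {1..r} \<Longrightarrow> \<psi> i \<noteq> principal_character (m i)"
    and Re_pos: "\<And>i. i \<le> r - 1 \<Longrightarrow> (\<Sum>j=r-i..r. Re (s j)) > 0"
begin

abbreviation "tail \<equiv> tail_symbol r \<psi> s"
abbreviation "tail_product d \<equiv> leibniz_mult (powr_symbol (s (r - d))) (tail d)"

text \<open>Multiplying by the power adds \<open>Re (s (r - d))\<close> to the decay exponent, and
  the integral against the character sum preserves it. The exponent is positive each time the
  integral is taken, by the hypothesis on the partial sums; single real parts may be
  negative.\<close>

lemma symbol_tail:
  "d \<le> r \<Longrightarrow> symbol (\<Sum>j\<in>{r-d<..r}. Re (s j)) (tail d)"
  "d < r \<Longrightarrow> symbol (\<Sum>j=r-d..r. Re (s j)) (tail_product d)"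
proof -
  have product: "symbol (\<Sum>j=r-d..r. Re (s j)) (tail_product d)"
    if "symbol (\<Sum>j\<in>{r-d<..r}. Re (s j)) (tail d)" for d
  proof -
    have "{r-d..r} = insert (r-d) {r-d<..r}" by auto
    then have "(\<Sum>j=r-d..r. Re (s j)) = Re (s (r-d)) + (\<Sum>j\<in>{r-d<..r}. Re (s j))" by simp
    then show ?thesis using symbol_leibniz_mult[OF symbol_powr that, of "s (r-d)"] by simp
  qed
  show tail: "d \<le> r \<Longrightarrow> symbol (\<Sum>j\<in>{r-d<..r}. Re (s j)) (tail d)" for d
  proof (induction d)
    case 0
    then show ?case using symbol_one by simp
  next
    case (Suc d)
    have "r - d \<in> {1..r}" using Suc.prems by auto
    then obtain B where B: "\<And>t. norm (character_sum (\<psi> (r - d)) t) \<le> B"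
      using character_sum_bounded[OF character nonprincipal] by metis
    have pos: "(\<Sum>j=r-d..r. Re (s j)) > 0" using Suc.prems by (intro Re_pos) auto
    have "symbol (\<Sum>j=r-d..r. Re (s j)) (tail_product d)"
      using Suc by (intro product) simp
    from symbol_char_integral[OF this pos B]
    have "symbol (\<Sum>j=r-d..r. Re (s j)) (tail (Suc d))" by simp
    moreover have "{r - Suc d<..r} = {r-d..r}" using Suc.prems by auto
    ultimately show ?case by simp
  qed
  show "d < r \<Longrightarrow> symbol (\<Sum>j=r-d..r. Re (s j)) (tail_product d)"
    by (rule product, rule tail) simp
qed

text \<open>At index 0 the Leibniz sum has a single term, so the Abel summation formula applies to
  the plain product of the power and the inner tail.\<close>

lemma tail_series:
  assumes "d < r" "y \<ge> 0"
  shows "(\<lambda>n. \<psi> (r - d) (Suc n) * (1 / of_real (y + real (Suc n)) powr s (r - d) * tail d 0 (y + real (Suc n))))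
           sums tail (Suc d) 0 y"
proof -
  have "r - d \<in> {1..r}" using assms by auto
  then obtain B where B: "\<And>t. norm (character_sum (\<psi> (r - d)) t) \<le> B"
    using character_sum_bounded[OF character nonprincipal] by metis
  have "(\<Sum>j=r-d..r. Re (s j)) > 0" using assms by (intro Re_pos) auto
  from char_integral_sums[OF symbol_tail(2)[OF assms(1)] this B assms(2), of 0]
  show ?thesis by (simp add: leibniz_mult_def powr_symbol_def)
qed

lemma tail_integrable:
  assumes "d < r" "y \<ge> 0"
  shows "set_integrable lborel {1..} (\<lambda>t. character_sum (\<psi> (r - d)) t * tail_product d (Suc k) (y + t))"
proof -
  have "r - d \<in> {1..r}" using assms by auto
  then obtain B where B: "\<And>t. norm (character_sum (\<psi> (r - d)) t) \<le> B"
    using character_sum_bounded[OF character nonprincipal] by metis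
  have "(\<Sum>j=r-d..r. Re (s j)) > 0" using assms by (intro Re_pos) auto
  from char_integral_integrable[OF symbol_tail(2)[OF assms(1)] this B assms(2)]
  show ?thesis .
qed

text \<open>The factors of the outer coordinates are constant with respect to the variable being
  summed and come out of the series. What remains is the series of \<open>tail_series\<close>, with
  \<open>y\<close> the sum of \<open>n\<^sub>0\<close> and the outer variables.\<close>

lemma iterated_series:
  assumes "d \<le> r"
  shows "iterated_summable (series_term r n\<^sub>0 \<psi> s) (Suc (r - d)) d n \<and>
         iterated_suminf (series_term r n\<^sub>0 \<psi> s) (Suc (r - d)) d n =
           (\<Prod>i=1..r-d. \<psi> i (n i)) / (\<Prod>i=1..r-d. of_nat (n\<^sub>0 + (\<Sum>j=1..i. n j)) powr s i) *
           tail d 0 (real (n\<^sub>0 + (\<Sum>j=1..r-d. n j)))"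
  using assms
proof (induction d arbitrary: n)
  case 0
  then show ?case by (simp add: series_term_def)
next
  case (Suc d)
  define q where "q = r - Suc d"
  have q: "r - d = Suc q" "d < r" using Suc.prems by (auto simp: q_def)
  let ?A = "(\<Prod>i=1..q. \<psi> i (n i)) / (\<Prod>i=1..q. of_nat (n\<^sub>0 + (\<Sum>j=1..i. n j)) powr s i)"
  let ?y = "real (n\<^sub>0 + (\<Sum>j=1..q. n j))"
  let ?t = "\<lambda>a. \<psi> (Suc q) (Suc a) * (1 / of_real (?y + real (Suc a)) powr s (Suc q) * tail d 0 (?y + real (Suc a)))"
  have val: "iterated_suminf (series_term r n\<^sub>0 \<psi> s) (Suc (Suc q)) d (n(Suc q := Suc a)) = ?A * ?t a" for a
  proof -
    let ?n = "n(Suc q := Suc a)"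
    have sum_n: "(\<Sum>j=1..Suc q. ?n j) = (\<Sum>j=1..q. n j) + Suc a"
      using sum_fun_upd_Suc[of q q n "Suc a"] by simp
    have "(\<Prod>i=1..q. \<psi> i (?n i)) = (\<Prod>i=1..q. \<psi> i (n i))"
      by (intro prod.cong) auto
    then have prod_\<psi>: "(\<Prod>i=1..Suc q. \<psi> i (?n i)) = (\<Prod>i=1..q. \<psi> i (n i)) * \<psi> (Suc q) (Suc a)"
      by simp
    have y: "real (n\<^sub>0 + (\<Sum>j=1..Suc q. ?n j)) = ?y + real (Suc a)"
      unfolding sum_n by simp
    have "(\<Prod>i=1..q. of_nat (n\<^sub>0 + (\<Sum>j=1..i. ?n j)) powr s i) =
        (\<Prod>i=1..q. complex_of_nat (n\<^sub>0 + (\<Sum>j=1..i. n j)) powr s i)"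
      by (intro prod.cong refl) (simp only: atLeastAtMost_iff sum_fun_upd_Suc)
    moreover have "complex_of_nat (n\<^sub>0 + (\<Sum>j=1..Suc q. ?n j)) = of_real (?y + real (Suc a))"
      unfolding y[symmetric] by (rule of_real_of_nat_eq[symmetric])
    ultimately have prod_powr: "(\<Prod>i=1..Suc q. of_nat (n\<^sub>0 + (\<Sum>j=1..i. ?n j)) powr s i) =
        (\<Prod>i=1..q. of_nat (n\<^sub>0 + (\<Sum>j=1..i. n j)) powr s i) * of_real (?y + real (Suc a)) powr s (Suc q)"
      by (simp only: prod.nat_ivl_Suc' le_add1 plus_1_eq_Suc One_nat_def Suc_le_mono le0 mult.commute)
    have "iterated_suminf (series_term r n\<^sub>0 \<psi> s) (Suc (Suc q)) d ?n =
        (\<Prod>i=1..Suc q. \<psi> i (?n i)) / (\<Prod>i=1..Suc q. of_nat (n\<^sub>0 + (\<Sum>j=1..i. ?n j)) powr s i) *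
          tail d 0 (real (n\<^sub>0 + (\<Sum>j=1..Suc q. ?n j)))"
      using Suc.IH[of ?n, unfolded q(1)] Suc.prems Suc_leD by blast
    then show ?thesis
      unfolding prod_\<psi> prod_powr y by simp
  qed
  have "(\<lambda>a. ?A * ?t a) sums (?A * tail (Suc d) 0 ?y)"
    by (rule sums_mult[OF tail_series[OF q(2) of_nat_0_le_iff, unfolded q(1)]])
  then show ?case
    using Suc.IH q(1) Suc.prems unfolding iterated_summable.simps iterated_suminf.simps q_def[symmetric] val
    by (auto simp: sums_iff)
qed

text \<open>Grouping the tuples by all but their last exponent turns the sum over that exponent into
  a derivative of \<open>tail_product d\<close>; integrating it against the character sum gives the
  next tail. The index \<open>r - d\<close> minus the tuple total counts the derivatives not yet
  placed.\<close>

lemma iterated_integrals: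
  assumes "d \<le> r" "\<And>i. i \<in> {1..r-d} \<Longrightarrow> x i \<ge> 1"
  shows "iterated_integrable (integrand r n\<^sub>0 \<psi> s) (Suc (r - d)) d x \<and>
         iterated_integral (integrand r n\<^sub>0 \<psi> s) (Suc (r - d)) d x =
           (\<Prod>i=1..r-d. character_sum (\<psi> i) (x i)) *
           (\<Sum>k\<in>partial_tuples (r - d). tuple_weight n\<^sub>0 s (r - d) k x *
              tail d (r - d - (\<Sum>j=1..r-d. k j)) (real n\<^sub>0 + (\<Sum>j=1..r-d. x j)))"
  using assms
proof (induction d arbitrary: x)
  case 0
  then show ?case using integrand_eq[OF r] by simp
next
  case (Suc d)
  define q where "q = r - Suc d"
  have q: "r - d = Suc q" "d < r" using Suc.prems by (auto simp: q_def)
  have x: "\<And>i. i \<in> {1..q} \<Longrightarrow> x i \<ge> 1" using Suc.prems(2) by (simp add: q_def)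
  let ?P = "\<Prod>i=1..q. character_sum (\<psi> i) (x i)"
  let ?y = "real n\<^sub>0 + (\<Sum>j=1..q. x j)"
  let ?g = "\<lambda>k t. character_sum (\<psi> (Suc q)) t * tail_product d (Suc (q - (\<Sum>j=1..q. k j))) (?y + t)"
  have y: "?y \<ge> 0"
    by (intro add_nonneg_nonneg sum_nonneg) (use x in \<open>force+\<close>)
  have IH: "iterated_integrable (integrand r n\<^sub>0 \<psi> s) (Suc (Suc q)) d (x(Suc q := t))"
    "iterated_integral (integrand r n\<^sub>0 \<psi> s) (Suc (Suc q)) d (x(Suc q := t)) =
       (\<Sum>k\<in>partial_tuples q. ?P * tuple_weight n\<^sub>0 s q k x * ?g k t)" if t: "t \<ge> 1" for t
  proof -
    let ?x = "x(Suc q := t)"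
    have ge: "?x i \<ge> 1" if "i \<in> {1..Suc q}" for i
      using that x[of i] t by auto
    have IH: "iterated_integrable (integrand r n\<^sub>0 \<psi> s) (Suc (Suc q)) d ?x \<and>
      iterated_integral (integrand r n\<^sub>0 \<psi> s) (Suc (Suc q)) d ?x =
        (\<Prod>i=1..Suc q. character_sum (\<psi> i) (?x i)) *
        (\<Sum>k\<in>partial_tuples (Suc q). tuple_weight n\<^sub>0 s (Suc q) k ?x *
           tail d (Suc q - (\<Sum>j=1..Suc q. k j)) (real n\<^sub>0 + (\<Sum>j=1..Suc q. ?x j)))"
      using Suc.IH[of ?x, unfolded q(1)] ge Suc.prems(1) Suc_leD by blast
    then show "iterated_integrable (integrand r n\<^sub>0 \<psi> s) (Suc (Suc q)) d ?x" ..
    have sum_x: "(\<Sum>j=1..Suc q. ?x j) = (\<Sum>j=1..q. x j) + t"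
      using sum_fun_upd_Suc[of q q x t] by simp
    have prod_x: "(\<Prod>i=1..Suc q. character_sum (\<psi> i) (?x i)) = ?P * character_sum (\<psi> (Suc q)) t"
    proof -
      have "(\<Prod>i=1..q. character_sum (\<psi> i) (?x i)) = ?P" by (intro prod.cong) auto
      then show ?thesis by simp
    qed
    have "(\<Sum>k\<in>partial_tuples (Suc q). tuple_weight n\<^sub>0 s (Suc q) k ?x *
        tail d (Suc q - (\<Sum>j=1..Suc q. k j)) (?y + t)) =
      (\<Sum>k\<in>partial_tuples q. tuple_weight n\<^sub>0 s q k x * tail_product d (Suc (q - (\<Sum>j=1..q. k j))) (?y + t))"
      unfolding sum_partial_tuples_Suc
    proof (rule sum.cong)
      fix k assume k: "k \<in> partial_tuples q"
      \<comment> \<open>The bound on the tuple total keeps the subtraction from truncating, so the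
        index really has the form \<open>Suc k\<close> required by
        \<open>char_integral\<close>.\<close>
      have Suc_diff: "Suc (q - (\<Sum>j=1..q. k j)) = Suc q - (\<Sum>j=1..q. k j)"
        using partial_tuples_sum_le[OF k] by (simp add: Suc_diff_le)
      have "(\<Sum>j=1..Suc q. (k(Suc q := v)) j) = (\<Sum>j=1..q. k j) + v" for v
        using sum_fun_upd_Suc[of q q k v] by simp
      then show "(\<Sum>v\<le>Suc q - (\<Sum>j=1..q. k j). tuple_weight n\<^sub>0 s (Suc q) (k(Suc q := v)) ?x *
          tail d (Suc q - (\<Sum>j=1..Suc q. (k(Suc q := v)) j)) (?y + t)) =
        tuple_weight n\<^sub>0 s q k x * tail_product d (Suc (q - (\<Sum>j=1..q. k j))) (?y + t)"
        unfolding tuple_weight_Suc leibniz_mult_def Suc_diff q(1) sum_distrib_left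
        by (simp only: diff_diff_left mult.assoc)
    qed simp
    moreover note conjunct2[OF IH]
    ultimately show "iterated_integral (integrand r n\<^sub>0 \<psi> s) (Suc (Suc q)) d ?x =
       (\<Sum>k\<in>partial_tuples q. ?P * tuple_weight n\<^sub>0 s q k x * ?g k t)"
      unfolding sum_x prod_x add.assoc[symmetric] by (simp only: sum_distrib_left) (simp only: ac_simps)
  qed
  have int: "set_integrable lborel {1..} (\<lambda>t. ?P * tuple_weight n\<^sub>0 s q k x * ?g k t)" for k
    using tail_integrable[OF q(2) y] unfolding q(1) by (intro set_integrable_mult_right)
  \<comment> \<open>Passing to the integral lowers the index by one: \<open>char_integral\<close> at
    index \<open>k\<close> integrates its argument at index \<open>Suc k\<close>.\<close>
  have eq: "(LINT t:{1..}|lborel. ?P * tuple_weight n\<^sub>0 s q k x * ?g k t) =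
      ?P * (tuple_weight n\<^sub>0 s q k x * tail (Suc d) (q - (\<Sum>j=1..q. k j)) ?y)" for k
    by (simp add: char_integral_def q(1) mult.assoc)
  have int_sum: "set_integrable lborel {1..} (\<lambda>t. \<Sum>k\<in>partial_tuples q. ?P * tuple_weight n\<^sub>0 s q k x * ?g k t)"
    using int unfolding set_integrable_def scaleR_sum_right by (intro Bochner_Integration.integrable_sum)
  \<comment> \<open>The induction hypothesis is available only for \<open>t \<ge> 1\<close>, so the
    integrands are exchanged on the domain of integration.\<close>
  have "set_integrable lborel {1..} (\<lambda>t. iterated_integral (integrand r n\<^sub>0 \<psi> s) (Suc (Suc q)) d (x(Suc q := t)))"
    using int_sum by (subst set_integrable_cong[OF refl refl IH(2)]) auto
  moreover have "(LINT t:{1..}|lborel. iterated_integral (integrand r n\<^sub>0 \<psi> s) (Suc (Suc q)) d (x(Suc q := t))) =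
      (LINT t:{1..}|lborel. \<Sum>k\<in>partial_tuples q. ?P * tuple_weight n\<^sub>0 s q k x * ?g k t)"
    by (rule set_lebesgue_integral_cong) (use IH(2) in auto)
  moreover have "\<dots> = (\<Sum>k\<in>partial_tuples q. LINT t:{1..}|lborel. ?P * tuple_weight n\<^sub>0 s q k x * ?g k t)"
    using int unfolding set_integrable_def set_lebesgue_integral_def scaleR_sum_right
    by (intro Bochner_Integration.integral_sum)
  ultimately show ?case
    unfolding iterated_integrable.simps iterated_integral.simps q_def[symmetric] eq sum_distrib_left[symmetric]
    using IH(1) by auto
qed

end

theorem theorem2:
  fixes r n\<^sub>0 :: nat
    and m :: "nat \<Rightarrow> nat"
    and \<psi> :: "nat \<Rightarrow> nat \<Rightarrow> complex"
    and s :: "nat \<Rightarrow> complex"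
  assumes "r \<ge> 1"
    and "\<And>i. i \<in> {1..r} \<Longrightarrow> dirichlet_character (m i) (\<psi> i)"
    and "\<And>i. i \<in> {1..r} \<Longrightarrow> \<psi> i \<noteq> principal_character (m i)"
    and "\<And>i. i \<le> r - 1 \<Longrightarrow> (\<Sum>j=r-i..r. Re (s j)) > 0"
  shows "iterated_summable (series_term r n\<^sub>0 \<psi> s) 1 r (\<lambda>_. 0) \<and>
         iterated_integrable (integrand r n\<^sub>0 \<psi> s) 1 r (\<lambda>_. 0) \<and>
         iterated_suminf (series_term r n\<^sub>0 \<psi> s) 1 r (\<lambda>_. 0) =
           iterated_integral (integrand r n\<^sub>0 \<psi> s) 1 r (\<lambda>_. 0)"
proof -
  interpret character_series r n\<^sub>0 m \<psi> s
    using assms by unfold_locales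
  show ?thesis
    \<comment> \<open>With \<open>d = r\<close> no outer coordinates remain: the only tuple is the
      empty one, of weight 1, and both sides reduce to \<open>tail r 0\<close> at
      \<open>real n\<^sub>0\<close>.\<close>
    using iterated_series[OF order_refl, of "\<lambda>_. 0"] iterated_integrals[OF order_refl, of "\<lambda>_. 0"]
    by (simp add: partial_tuples_0 tuple_weight_def)
qed

end
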